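(* Every nonempty metric space of unbounded geometry contains a subspace which is macro-uniformly equivalent to the Baire macro-space $\omega^{<\mathbb N}$.
   Context: Notation: $\mathbb N=\{1,2,3,\dots\}$, $\omega=\{0,1,2,\dots\}$ (also used as the first infinite cardinal). The Baire macro-space is $$\omega^{<\mathbb N}=\{(x_i)_{i\in\mathbb N}\in\omega^{\mathbb N}:\exists n\in\mathbb N\ \forall i>n\ \ x_i=0\}$$ with the ultrametric $d((x_i),(y_i))=\max(\{0\}\cup\{i\in\mathbb N:x_i\ne y_i\})$. Multi-maps: a multi-map $\Phi:X\Rightarrow Y$ between sets is a subset $\Phi\subset X\times Y$. For $A\subset X$, $\Phi(A)=\{y\in Y:\exists a\in A,\ (a,y)\in\Phi\}$, and $\Phi^{-1}=\{(y,x):(x,y)\in\Phi\}:Y\Rightarrow X$. For metric spaces $X,Y$ the oscillation of $\Phi$ is the function $\omega_\Phi:[0,\infty)\to[0,\infty]$, $\omega_\Phi(\delta)=\sup\{\operatorname{diam}\Phi(A):A\subset X,\ \operatorname{diam}A\le\delta\}$ (with $\operatorname{diam}\emptyset=0$). $\Phi$ is macro-uniform if $\omega_\Phi(\delta)<\infty$ for all $\delta<\infty$. $\Phi$ is a macro-uniform equivalence if $\Phi^{-1}(Y)=X$, $\Phi(X)=Y$, and both $\Phi$ and $\Phi^{-1}$ are macro-uniform. Metric spaces $X,Y$ are macro-uniformly equivalent if there is a macro-uniform equivalence $\Phi:X\Rightarrow Y$. Unbounded geometry: for a metric space $X$, $A\subset X$ and a real $\delta>0$, $\operatorname{cov}_\delta(A)$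 is the smallest cardinality of a cover of $A$ by sets of diameter $\le\delta$. With $B_\varepsilon(x)=\{y\in X:d(x,y)\le\varepsilon\}$, put $\operatorname{cov}_\delta^\varepsilon(X)=\min_{x\in X}\operatorname{cov}_\delta(B_\varepsilon(x))$ for positive reals $\delta,\varepsilon$. $X$ has unbounded geometry if for every $\delta<\infty$ there is $\varepsilon<\infty$ with $\operatorname{cov}_\delta^\varepsilon(X)\ge\omega$ (i.e. no closed $\varepsilon$-ball of $X$ can be covered by finitely many sets of diameter $\le\delta$). Subspaces carry the restricted metric. *)

theory Defs
  imports "HOL-Analysis.Analysis"
begin

unbundle cardinal_syntax

definition mdiam :: "'a metric \<Rightarrow> 'a set \<Rightarrow> ennreal" where
  "mdiam X A = (SUP (x, y) \<in> A \<times> A. ennreal (mdist X x y))"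

lemma mdiam_empty: "mdiam X {} = 0"
  by (simp add: mdiam_def bot_ennreal)

lemma mdiam_le_iff:
  assumes "0 \<le> r"
  shows "mdiam X A \<le> ennreal r \<longleftrightarrow> (\<forall>x\<in>A. \<forall>y\<in>A. mdist X x y \<le> r)"
  using assms by (auto simp: mdiam_def SUP_le_iff ennreal_le_iff)

definition oscillation ::
    "'a metric \<Rightarrow> 'b metric \<Rightarrow> ('a \<times> 'b) set \<Rightarrow> real \<Rightarrow> ennreal" where
  "oscillation X Y \<Phi> \<delta> =
     (SUP A \<in> {A. A \<subseteq> mspace X \<and> mdiam X A \<le> ennreal \<delta>}. mdiam Y (\<Phi> `` A))"

definition macro_uniform :: "'a metric \<Rightarrow> 'b metric \<Rightarrow> ('a \<times> 'b) set \<Rightarrow> bool" where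
  "macro_uniform X Y \<Phi> \<longleftrightarrow>
     \<Phi> \<subseteq> mspace X \<times> mspace Y \<and> (\<forall>\<delta>\<ge>0. oscillation X Y \<Phi> \<delta> < \<infinity>)"

definition macro_uniform_equivalence ::
    "'a metric \<Rightarrow> 'b metric \<Rightarrow> ('a \<times> 'b) set \<Rightarrow> bool" where
  "macro_uniform_equivalence X Y \<Phi> \<longleftrightarrow>
     \<Phi>\<inverse> `` mspace Y = mspace X \<and> \<Phi> `` mspace X = mspace Y \<and>
     macro_uniform X Y \<Phi> \<and> macro_uniform Y X (\<Phi>\<inverse>)"

definition macro_uniformly_equivalent :: "'a metric \<Rightarrow> 'b metric \<Rightarrow> bool" where
  "macro_uniformly_equivalent X Y \<longleftrightarrow> (\<exists>\<Phi>. macro_uniform_equivalence X Y \<Phi>)"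

(* Cardinals are represented by well-order relations, so a least one is unique only up to =o;
   the choice made here is therefore immaterial for comparisons by \<le>o. *)
definition min_cardinal :: "'b rel set \<Rightarrow> 'b rel" where
  "min_cardinal R = (SOME r. r \<in> R \<and> (\<forall>r'\<in>R. r \<le>o r'))"

lemma min_cardinal:
  assumes "R \<noteq> {}" and "\<And>r. r \<in> R \<Longrightarrow> Card_order r"
  shows "min_cardinal R \<in> R" and "r' \<in> R \<Longrightarrow> min_cardinal R \<le>o r'"
proof -
  have "\<exists>r. r \<in> R \<and> (\<forall>r'\<in>R. r \<le>o r')"
    using exists_minim_Card_order[of R] assms by blast
  from someI_ex[OF this]
  show "min_cardinal R \<in> R" and "r' \<in> R \<Longrightarrow> min_cardinal R \<le>o r'"
    by (auto simp: min_cardinal_def)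
qed

definition diam_covers :: "'a metric \<Rightarrow> real \<Rightarrow> 'a set \<Rightarrow> 'a set set set" where
  "diam_covers X \<delta> A =
     {\<C>. \<C> \<subseteq> Pow (mspace X) \<and> A \<subseteq> \<Union>\<C> \<and> (\<forall>C\<in>\<C>. mdiam X C \<le> ennreal \<delta>)}"

definition cov :: "'a metric \<Rightarrow> real \<Rightarrow> 'a set \<Rightarrow> 'a set rel" where
  "cov X \<delta> A = min_cardinal (card_of ` diam_covers X \<delta> A)"

definition min_ball_cov :: "'a metric \<Rightarrow> real \<Rightarrow> real \<Rightarrow> 'a set rel" where
  "min_ball_cov X \<delta> \<epsilon> = min_cardinal ((\<lambda>x. cov X \<delta> (mcball_of X x \<epsilon>)) ` mspace X)"

definition unbounded_geometry :: "'a metric \<Rightarrow> bool" where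
  "unbounded_geometry X \<longleftrightarrow> (\<forall>\<delta>>0. \<exists>\<epsilon>>0. natLeq \<le>o min_ball_cov X \<delta> \<epsilon>)"

lemma diam_covers_nonempty:
  assumes "A \<subseteq> mspace X"
  shows "diam_covers X \<delta> A \<noteq> {}"
proof -
  have "(\<lambda>x. {x}) ` A \<in> diam_covers X \<delta> A"
    using assms by (auto simp: diam_covers_def mdiam_def Metric_space.mdist_zero[OF Metric_space_mspace_mdist] subset_iff)
  then show ?thesis by blast
qed

lemma natLeq_le_cov_iff:
  assumes "A \<subseteq> mspace X"
  shows "Card_order (cov X \<delta> A)"
    and "natLeq \<le>o cov X \<delta> A \<longleftrightarrow> (\<forall>\<C>\<in>diam_covers X \<delta> A. infinite \<C>)"
proof -
  let ?R = "card_of ` diam_covers X \<delta> A"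
  have ne: "?R \<noteq> {}" and co: "\<And>r. r \<in> ?R \<Longrightarrow> Card_order r"
    using diam_covers_nonempty[OF assms] by (auto simp: card_of_Card_order)
  note min = min_cardinal[OF ne co, folded cov_def]
  show "Card_order (cov X \<delta> A)"
    using min(1) co by blast
  show "natLeq \<le>o cov X \<delta> A \<longleftrightarrow> (\<forall>\<C>\<in>diam_covers X \<delta> A. infinite \<C>)"
  proof
    assume "natLeq \<le>o cov X \<delta> A"
    then show "\<forall>\<C>\<in>diam_covers X \<delta> A. infinite \<C>"
      using min(2) ordLeq_transitive infinite_iff_natLeq_ordLeq by blast
  next
    assume "\<forall>\<C>\<in>diam_covers X \<delta> A. infinite \<C>"
    then show "natLeq \<le>o cov X \<delta> A"
      using min(1) infinite_iff_natLeq_ordLeq by (metis imageE)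
  qed
qed

lemma unbounded_geometry_iff:
  assumes "mspace X \<noteq> {}"
  shows "unbounded_geometry X \<longleftrightarrow>
    (\<forall>\<delta>>0. \<exists>\<epsilon>>0. \<forall>x\<in>mspace X. \<forall>\<C>\<in>diam_covers X \<delta> (mcball_of X x \<epsilon>). infinite \<C>)"
proof -
  have sub: "mcball_of X x \<epsilon> \<subseteq> mspace X" for x \<epsilon> by auto
  have "natLeq \<le>o min_ball_cov X \<delta> \<epsilon> \<longleftrightarrow>
      (\<forall>x\<in>mspace X. natLeq \<le>o cov X \<delta> (mcball_of X x \<epsilon>))" for \<delta> \<epsilon>
  proof -
    let ?R = "(\<lambda>x. cov X \<delta> (mcball_of X x \<epsilon>)) ` mspace X"
    have ne: "?R \<noteq> {}" and co: "\<And>r. r \<in> ?R \<Longrightarrow> Card_order r"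
      using assms natLeq_le_cov_iff(1)[OF sub] by auto
    show ?thesis
      using min_cardinal[OF ne co, folded min_ball_cov_def]
      by (auto intro: ordLeq_transitive)
  qed
  then show ?thesis
    by (simp add: unbounded_geometry_def natLeq_le_cov_iff(2)[OF sub])
qed

definition baire_carrier :: "(nat \<Rightarrow> nat) set" where
  "baire_carrier = {x \<in> {1..} \<rightarrow>\<^sub>E UNIV. \<exists>n\<ge>1. \<forall>i>n. x i = 0}"

definition baire_dist :: "(nat \<Rightarrow> nat) \<Rightarrow> (nat \<Rightarrow> nat) \<Rightarrow> real" where
  "baire_dist x y = real (Max ({0} \<union> {i \<in> {1..}. x i \<noteq> y i}))"

definition baire_macro_space :: "(nat \<Rightarrow> nat) metric" where
  "baire_macro_space = metric (baire_carrier, baire_dist)"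

lemma finite_baire_diff:
  assumes "x \<in> baire_carrier" "y \<in> baire_carrier"
  shows "finite {i \<in> {1..}. x i \<noteq> y i}"
proof -
  obtain m n where "\<forall>i>m. x i = 0" "\<forall>i>n. y i = 0"
    using assms by (auto simp: baire_carrier_def)
  then have "{i \<in> {1..}. x i \<noteq> y i} \<subseteq> {..max m n}"
    by (auto simp: not_less[symmetric])
  then show ?thesis by (rule finite_subset) simp
qed

lemma baire_dist_le_iff:
  assumes "x \<in> baire_carrier" "y \<in> baire_carrier"
  shows "baire_dist x y \<le> real n \<longleftrightarrow> (\<forall>i>n. x i = y i)"
proof -
  have "baire_dist x y \<le> real n \<longleftrightarrow> (\<forall>i\<in>{0} \<union> {i \<in> {1..}. x i \<noteq> y i}. i \<le> n)"
    unfolding baire_dist_def of_nat_le_iff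
    by (subst Max_le_iff) (use finite_baire_diff[OF assms] in auto)
  also have "\<dots> \<longleftrightarrow> (\<forall>i. i \<ge> 1 \<and> x i \<noteq> y i \<longrightarrow> i \<le> n)"
    by auto
  also have "\<dots> \<longleftrightarrow> (\<forall>i>n. x i = y i)"
    by (intro iff_allI) linarith
  finally show ?thesis .
qed

lemma Metric_space_baire: "Metric_space baire_carrier baire_dist"
proof
  fix x y z
  show "0 \<le> baire_dist x y" by (simp add: baire_dist_def)
  show "baire_dist x y = baire_dist y x" by (simp add: baire_dist_def eq_commute)
  {
    assume x: "x \<in> baire_carrier" and y: "y \<in> baire_carrier"
    have "baire_dist x y = 0 \<longleftrightarrow> baire_dist x y \<le> real 0"
      by (simp add: baire_dist_def)
    also have "\<dots> \<longleftrightarrow> (\<forall>i>0. x i = y i)"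
      by (rule baire_dist_le_iff[OF x y])
    also have "\<dots> \<longleftrightarrow> x = y"
    proof
      assume "\<forall>i>0. x i = y i"
      then show "x = y"
        using x y by (intro PiE_ext[of x "{1..}" "\<lambda>_. UNIV" y]) (auto simp: baire_carrier_def)
    qed simp
    finally show "baire_dist x y = 0 \<longleftrightarrow> x = y" .
    assume z: "z \<in> baire_carrier"
    obtain m n where m: "baire_dist x y = real m" and n: "baire_dist y z = real n"
      by (simp add: baire_dist_def)
    have "\<forall>i>m. x i = y i" "\<forall>i>n. y i = z i"
      using baire_dist_le_iff[OF x y, of m] baire_dist_le_iff[OF y z, of n] m n by auto
    then have "\<forall>i>m + n. x i = z i" by simp
    then have "baire_dist x z \<le> real (m + n)"
      using baire_dist_le_iff[OF x z] by blast
    then show "baire_dist x z \<le> baire_dist x y + baire_dist y z"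
      by (simp add: m n)
  }
qed

lemma mspace_baire: "mspace baire_macro_space = baire_carrier"
  and mdist_baire: "mdist baire_macro_space = baire_dist"
  by (simp_all add: baire_macro_space_def Metric_space_baire
      Metric_space.mspace_metric Metric_space.mdist_metric)

end

theory Submission
  imports Defs
begin

text \<open>
  In a space of unbounded geometry every point \<open>q\<close> is, at every scale \<open>\<delta>\<close>, the root of an infinite
  \<^emph>\<open>fan\<close>: a sequence of points starting with \<open>q\<close>, pairwise more than \<open>\<delta>\<close> apart, and all within a
  distance \<open>\<epsilon>\<close> of \<open>q\<close> that depends on \<open>\<delta>\<close> only (\<open>unbounded_geometry_imp_fan\<close>). A point
  \<open>(x\<^sub>1, \<dots>, x\<^sub>n, 0, 0, \<dots>)\<close> of the Baire macro-space is read as an itinerary: from a fixed base point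
  move to the member number \<open>x\<^sub>n\<close> of a fan at the \<open>n\<close>-th scale, from there to the member number
  \<open>x\<^bsub>n-1\<^esub>\<close> of a fan at the next lower scale, and so on down to \<open>x\<^sub>1\<close>. Since each fan starts
  with its root, trailing zeros cause no movement, so the end point depends on \<open>x\<close> alone.

  Let \<open>E n\<close> bound the total length of the moves at the lowest \<open>n\<close> scales. Two itineraries that
  agree beyond coordinate \<open>n\<close> reach a common point before those moves, so they end at most
  \<open>2 * E n\<close> apart (\<open>descend_upper_bound\<close>). If \<open>n + 1\<close> is the last coordinate in which they differ,
  they pass through different members of one fan and afterwards move by at most \<open>E n\<close> each;
  when the fan is separated by \<open>2 * E n + (n + 1)\<close>, their end points are more than \<open>n + 1\<close> apart
  (\<open>descend_lower_bound\<close>). The scales can be chosen in this way one after the other, as \<open>E n\<close>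
  involves only the scales below the one to be chosen. The end point map is thus a
  non-contracting and macro-uniform injection, and its image
  is the subspace sought.
\<close>

section \<open>Infinite separated fans\<close>

text \<open>
  The fan is built greedily: the balls of radius \<open>\<delta>\<close> around finitely many points have
  diameter at most \<open>2 * \<delta>\<close>, hence cannot cover the \<open>\<epsilon>\<close>-ball and leave room for a further point.
\<close>

lemma unbounded_geometry_imp_fan:
  fixes X :: "'a metric"
  assumes "unbounded_geometry X" and "\<delta> > 0"
  shows "\<exists>\<epsilon>>0. \<forall>q\<in>mspace X. \<exists>h::nat \<Rightarrow> 'a. h 0 = q \<and> range h \<subseteq> mcball_of X q \<epsilon> \<and>
           (\<forall>i j. i \<noteq> j \<longrightarrow> mdist X (h i) (h j) > \<delta>)"
proof (cases "mspace X = {}")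
  case True
  then show ?thesis by (auto intro: exI[of _ 1])
next
  case False
  interpret M: Metric_space "mspace X" "mdist X" by (rule Metric_space_mspace_mdist)
  have "2 * \<delta> > 0" using assms(2) by simp
  then obtain \<epsilon> where "\<epsilon> > 0"
    and \<epsilon>: "\<And>q \<C>. q \<in> mspace X \<Longrightarrow> \<C> \<in> diam_covers X (2 * \<delta>) (mcball_of X q \<epsilon>) \<Longrightarrow> infinite \<C>"
    using assms(1)[unfolded unbounded_geometry_iff[OF False], rule_format, of "2 * \<delta>"] by blast
  have "\<exists>h::nat \<Rightarrow> 'a. h 0 = q \<and> range h \<subseteq> mcball_of X q \<epsilon> \<and>
          (\<forall>i j. i \<noteq> j \<longrightarrow> mdist X (h i) (h j) > \<delta>)" if q: "q \<in> mspace X" for q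
  proof -
    have room: "\<exists>r \<in> mcball_of X q \<epsilon>. \<forall>a\<in>A. mdist X a r > \<delta>"
      if A: "finite A" "A \<subseteq> mspace X" for A
    proof (rule ccontr)
      assume neg: "\<not> ?thesis"
      have "mdist X y z \<le> 2 * \<delta>"
        if "a \<in> A" "y \<in> mcball_of X a \<delta>" "z \<in> mcball_of X a \<delta>" for a y z
        using that M.triangle[of y a z] M.commute[of y a] by simp
      then have "mdiam X (mcball_of X a \<delta>) \<le> ennreal (2 * \<delta>)" if "a \<in> A" for a
        using that \<open>2 * \<delta> > 0\<close> by (simp only: mdiam_le_iff[OF less_imp_le]) blast
      moreover have "mcball_of X q \<epsilon> \<subseteq> (\<Union>a\<in>A. mcball_of X a \<delta>)"
      proof
        fix r
        assume r: "r \<in> mcball_of X q \<epsilon>"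
        then obtain a where "a \<in> A" "mdist X a r \<le> \<delta>"
          using neg by (meson not_less)
        then show "r \<in> (\<Union>a\<in>A. mcball_of X a \<delta>)"
          using r A(2) by auto
      qed
      ultimately have "(\<lambda>a. mcball_of X a \<delta>) ` A \<in> diam_covers X (2 * \<delta>) (mcball_of X q \<epsilon>)"
        by (auto simp: diam_covers_def)
      with \<epsilon>[OF q] A(1) show False by blast
    qed
    have "\<exists>h::nat \<Rightarrow> 'a. \<forall>n. h n \<in> mcball_of X q \<epsilon> \<and> (n = 0 \<longrightarrow> h n = q) \<and>
            (\<forall>m<n. mdist X (h m) (h n) > \<delta>)"
    proof (rule dependent_wellorder_choice)
      fix n :: nat and h :: "nat \<Rightarrow> 'a"
      assume "\<And>m. m < n \<Longrightarrow> h m \<in> mcball_of X q \<epsilon> \<and> (m = 0 \<longrightarrow> h m = q) \<and>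
                (\<forall>k<m. mdist X (h k) (h m) > \<delta>)"
      then have "h ` {..<n} \<subseteq> mspace X" by auto
      then obtain r where "r \<in> mcball_of X q \<epsilon>" "\<forall>a\<in>h ` {..<n}. mdist X a r > \<delta>"
        using room[of "h ` {..<n}"] by blast
      moreover have "q \<in> mcball_of X q \<epsilon>"
        using q \<open>\<epsilon> > 0\<close> by simp
      ultimately show "\<exists>r. r \<in> mcball_of X q \<epsilon> \<and> (n = 0 \<longrightarrow> r = q) \<and>
                         (\<forall>m<n. mdist X (h m) r > \<delta>)"
        by (cases "n = 0") auto
    qed auto
    then obtain h :: "nat \<Rightarrow> 'a" where h: "\<And>n. h n \<in> mcball_of X q \<epsilon>" "h 0 = q"
      and lt: "\<And>m n. m < n \<Longrightarrow> mdist X (h m) (h n) > \<delta>"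
      by blast
    have "mdist X (h i) (h j) > \<delta>" if "i \<noteq> j" for i j
      using that lt[of i j] lt[of j i] M.commute[of "h i" "h j"] by (cases i j rule: linorder_cases) auto
    with h show ?thesis by blast
  qed
  with \<open>\<epsilon> > 0\<close> show ?thesis by blast
qed

section \<open>Following an itinerary through fans\<close>

text \<open>
  Here \<open>g n q\<close> is the fan with root \<open>q\<close> at the scale that belongs to coordinate \<open>Suc n\<close>: the
  coordinates of the Baire macro-space are numbered from 1.
\<close>

primrec descend :: "(nat \<Rightarrow> 'a \<Rightarrow> nat \<Rightarrow> 'a) \<Rightarrow> (nat \<Rightarrow> nat) \<Rightarrow> nat \<Rightarrow> 'a \<Rightarrow> 'a" where
  "descend g x 0 q = q"
| "descend g x (Suc n) q = descend g x n (g n q (x (Suc n)))"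

locale fan_system =
  fixes X :: "'a metric" and g :: "nat \<Rightarrow> 'a \<Rightarrow> nat \<Rightarrow> 'a" and E :: "nat \<Rightarrow> real"
  assumes fan_closed: "q \<in> mspace X \<Longrightarrow> g n q i \<in> mspace X"
    and fan_root: "q \<in> mspace X \<Longrightarrow> g n q 0 = q"
    and fan_near: "q \<in> mspace X \<Longrightarrow> mdist X q (g n q i) \<le> E (Suc n) - E n"
    and fan_apart: "q \<in> mspace X \<Longrightarrow> i \<noteq> j \<Longrightarrow>
      mdist X (g n q i) (g n q j) > 2 * E n + real (Suc n)"
    and E_0: "E 0 = 0"
begin

sublocale Metric_space "mspace X" "mdist X"
  by (rule Metric_space_mspace_mdist)

lemma descend_closed: "q \<in> mspace X \<Longrightarrow> descend g x n q \<in> mspace X"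
  by (induction n arbitrary: q) (auto simp: fan_closed)

lemma descend_near: "q \<in> mspace X \<Longrightarrow> mdist X q (descend g x n q) \<le> E n"
proof (induction n arbitrary: q)
  case 0
  then show ?case by (simp add: E_0)
next
  case (Suc n)
  let ?r = "g n q (x (Suc n))"
  have r: "?r \<in> mspace X" using Suc.prems by (rule fan_closed)
  show ?case
    using triangle[OF Suc.prems r descend_closed[OF r, of x n]] Suc.IH[OF r]
      fan_near[OF Suc.prems, of n "x (Suc n)"] by simp
qed

lemma descend_ignores_trailing_zeros:
  assumes "q \<in> mspace X" and "\<And>i. i > k \<Longrightarrow> x i = 0" and "k \<le> n"
  shows "descend g x n q = descend g x k q"
  using assms(3) by (induction n rule: dec_induct) (auto simp: assms fan_root)

lemma descend_common_prefix:
  assumes "q \<in> mspace X" and "\<And>i. i > k \<Longrightarrow> x i = y i" and "k \<le> n"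
  shows "\<exists>r\<in>mspace X. descend g x n q = descend g x k r \<and> descend g y n q = descend g y k r"
  using assms(3,1)
proof (induction n arbitrary: q rule: dec_induct)
  case base
  then show ?case by blast
next
  case (step n)
  then show ?case using assms(2)[of "Suc n"] fan_closed by simp
qed

lemma descend_upper_bound:
  assumes "q \<in> mspace X" and "\<And>i. i > k \<Longrightarrow> x i = y i" and "k \<le> n"
  shows "mdist X (descend g x n q) (descend g y n q) \<le> 2 * E k"
proof -
  obtain r where r: "r \<in> mspace X"
    "descend g x n q = descend g x k r" "descend g y n q = descend g y k r"
    using descend_common_prefix assms by blast
  show ?thesis
    using triangle[OF descend_closed r(1) descend_closed, of r r x k y k]
      descend_near[OF r(1), of x k] descend_near[OF r(1), of y k] r
    by (simp add: commute)
qed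

text \<open>
  The margin \<open>2 * E k\<close> in the separation of the fan absorbs the moves that both itineraries make
  after they have parted.
\<close>

lemma descend_lower_bound:
  assumes "q \<in> mspace X" and "\<And>i. i > Suc k \<Longrightarrow> x i = y i" and "x (Suc k) \<noteq> y (Suc k)"
    and "Suc k \<le> n"
  shows "mdist X (descend g x n q) (descend g y n q) > real (Suc k)"
proof -
  obtain r where r: "r \<in> mspace X"
    and x: "descend g x n q = descend g x (Suc k) r"
    and y: "descend g y n q = descend g y (Suc k) r"
    using descend_common_prefix assms by blast
  define a b where "a = g k r (x (Suc k))" and "b = g k r (y (Suc k))"
  have M: "a \<in> mspace X" "b \<in> mspace X"
    using r by (auto simp: a_def b_def fan_closed)
  let ?a = "descend g x k a" and ?b = "descend g y k b"
  have M': "?a \<in> mspace X" "?b \<in> mspace X"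
    using M by (auto simp: descend_closed)
  have "2 * E k + real (Suc k) < mdist X a b"
    unfolding a_def b_def by (rule fan_apart[OF r assms(3)])
  also have "\<dots> \<le> mdist X a ?a + mdist X ?a ?b + mdist X b ?b"
    using triangle[OF M(1) M'(1) M(2)] triangle[OF M'(1,2) M(2)] by (simp add: commute)
  also have "\<dots> \<le> 2 * E k + mdist X ?a ?b"
    using descend_near[OF M(1), of x k] descend_near[OF M(2), of y k] by simp
  finally show ?thesis by (simp add: x y a_def b_def)
qed

text \<open>
  The choice of the starting level is immaterial because trailing zeros do not move the point; this
  lets one start two itineraries at the same level when they are compared.
\<close>

definition endpoint :: "'a \<Rightarrow> (nat \<Rightarrow> nat) \<Rightarrow> 'a" where
  "endpoint p x = descend g x (LEAST n. \<forall>i>n. x i = 0) p"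

lemma endpoint_closed: "p \<in> mspace X \<Longrightarrow> endpoint p x \<in> mspace X"
  by (simp add: endpoint_def descend_closed)

lemma endpoint_eq_descend:
  assumes "p \<in> mspace X" and "\<forall>i>n. x i = 0"
  shows "endpoint p x = descend g x n p"
proof -
  define k where "k = (LEAST n. \<forall>i>n. x i = 0)"
  have "\<forall>i>k. x i = 0"
    unfolding k_def using assms(2) by (rule LeastI[of "\<lambda>n. \<forall>i>n. x i = 0"])
  moreover have "k \<le> n"
    unfolding k_def using assms(2) by (rule Least_le[of "\<lambda>n. \<forall>i>n. x i = 0"])
  ultimately show ?thesis
    using descend_ignores_trailing_zeros[OF assms(1), of k x n]
    by (simp add: endpoint_def k_def[symmetric])
qed

lemma endpoints_eq_descend:
  assumes "p \<in> mspace X" and "x \<in> baire_carrier" and "y \<in> baire_carrier"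
  obtains n where "n \<ge> k" and "endpoint p x = descend g x n p" and "endpoint p y = descend g y n p"
proof -
  obtain m m' where "\<forall>i>m. x i = 0" "\<forall>i>m'. y i = 0"
    using assms(2,3) by (auto simp: baire_carrier_def)
  then show ?thesis
    using assms(1)
    by (intro that[of "max k (max m m')"]) (auto intro!: endpoint_eq_descend)
qed

lemma endpoint_upper_bound:
  assumes "p \<in> mspace X" and "x \<in> baire_carrier" and "y \<in> baire_carrier"
    and "baire_dist x y \<le> real k"
  shows "mdist X (endpoint p x) (endpoint p y) \<le> 2 * E k"
proof -
  obtain n where "n \<ge> k" "endpoint p x = descend g x n p" "endpoint p y = descend g y n p"
    using endpoints_eq_descend assms by blast
  moreover have "\<And>i. i > k \<Longrightarrow> x i = y i"
    using baire_dist_le_iff assms(2-4) by blast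
  ultimately show ?thesis
    using descend_upper_bound[OF assms(1)] by simp
qed

lemma endpoint_lower_bound:
  assumes "p \<in> mspace X" and "x \<in> baire_carrier" and "y \<in> baire_carrier"
  shows "baire_dist x y \<le> mdist X (endpoint p x) (endpoint p y)"
proof -
  obtain d where d: "baire_dist x y = real d"
    by (simp add: baire_dist_def)
  show ?thesis
  proof (cases d)
    case 0
    then show ?thesis by (simp add: d)
  next
    case (Suc k)
    have above: "\<forall>i>Suc k. x i = y i"
      using baire_dist_le_iff[OF assms(2,3), of "Suc k"] d Suc by simp
    moreover have "\<not> (\<forall>i>k. x i = y i)"
      using baire_dist_le_iff[OF assms(2,3), of k] d Suc by simp
    ultimately have "x (Suc k) \<noteq> y (Suc k)"
      by (metis Suc_lessI)
    moreover obtain n where "n \<ge> Suc k"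
      "endpoint p x = descend g x n p" "endpoint p y = descend g y n p"
      using endpoints_eq_descend assms by blast
    ultimately show ?thesis
      using descend_lower_bound[OF assms(1), of k x y n] above d Suc by simp
  qed
qed

end

text \<open>
  The separation required at a scale is computed from the bounds at the lower scales, so the
  scales are fixed recursively, starting from the lowest one.
\<close>

lemma unbounded_geometry_imp_fan_system:
  assumes "unbounded_geometry X"
  shows "\<exists>g E. fan_system X g E"
proof -
  obtain \<epsilon> where "\<forall>\<delta>>0. \<forall>q\<in>mspace X. \<exists>h::nat \<Rightarrow> 'a. h 0 = q \<and>
      range h \<subseteq> mcball_of X q (\<epsilon> \<delta>) \<and> (\<forall>i j. i \<noteq> j \<longrightarrow> mdist X (h i) (h j) > \<delta>)"
    and pos: "\<And>\<delta>. \<delta> > 0 \<Longrightarrow> \<epsilon> \<delta> > (0::real)"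
    using unbounded_geometry_imp_fan[OF assms] by metis
  then obtain h :: "real \<Rightarrow> 'a \<Rightarrow> nat \<Rightarrow> 'a" where h: "\<And>\<delta> q. \<delta> > 0 \<Longrightarrow> q \<in> mspace X \<Longrightarrow>
      h \<delta> q 0 = q \<and> range (h \<delta> q) \<subseteq> mcball_of X q (\<epsilon> \<delta>) \<and>
      (\<forall>i j. i \<noteq> j \<longrightarrow> mdist X (h \<delta> q i) (h \<delta> q j) > \<delta>)"
    by metis
  define E where "E = rec_nat 0 (\<lambda>n e. e + \<epsilon> (2 * e + real (Suc n)))"
  have E_0: "E 0 = 0" and E_Suc: "\<And>n. E (Suc n) = E n + \<epsilon> (2 * E n + real (Suc n))"
    by (simp_all add: E_def)
  have "E n \<ge> 0" for n
  proof (induction n)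
    case (Suc n)
    then show ?case using pos[of "2 * E n + real (Suc n)"] by (simp add: E_Suc)
  qed (simp add: E_0)
  then have scale: "2 * E n + real (Suc n) > 0" for n
    by (simp add: add_nonneg_pos)
  have "fan_system X (\<lambda>n. h (2 * E n + real (Suc n))) E"
  proof
    fix q n i j
    assume q: "q \<in> mspace X"
    note * = h[OF scale[of n] q]
    have "h (2 * E n + real (Suc n)) q i \<in> mcball_of X q (\<epsilon> (2 * E n + real (Suc n)))"
      using * by blast
    then show "h (2 * E n + real (Suc n)) q i \<in> mspace X"
      and "mdist X q (h (2 * E n + real (Suc n)) q i) \<le> E (Suc n) - E n"
      unfolding E_Suc in_mcball_of by simp_all
    show "h (2 * E n + real (Suc n)) q 0 = q"
      using * by blast
    show "2 * E n + real (Suc n) <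
        mdist X (h (2 * E n + real (Suc n)) q i) (h (2 * E n + real (Suc n)) q j)" if "i \<noteq> j"
      using * that by blast
  qed (rule E_0)
  then show ?thesis by blast
qed

section \<open>Macro-uniform equivalences from pointwise bounds\<close>

lemma macro_uniformI:
  assumes "\<Phi> \<subseteq> mspace X \<times> mspace Y"
    and "\<And>\<delta>. \<delta> \<ge> 0 \<Longrightarrow> \<exists>r\<ge>0. \<forall>(a, b)\<in>\<Phi>. \<forall>(a', b')\<in>\<Phi>. mdist X a a' \<le> \<delta> \<longrightarrow> mdist Y b b' \<le> r"
  shows "macro_uniform X Y \<Phi>"
  unfolding macro_uniform_def
proof (intro conjI allI impI)
  fix \<delta> :: real
  assume "\<delta> \<ge> 0"
  then obtain r where r: "r \<ge> 0"
    "\<forall>(a, b)\<in>\<Phi>. \<forall>(a', b')\<in>\<Phi>. mdist X a a' \<le> \<delta> \<longrightarrow> mdist Y b b' \<le> r"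
    using assms(2)[of \<delta>] by auto
  have "mdiam Y (\<Phi> `` A) \<le> ennreal r" if "mdiam X A \<le> ennreal \<delta>" for A
    using that r(2) unfolding mdiam_le_iff[OF \<open>\<delta> \<ge> 0\<close>] mdiam_le_iff[OF r(1)] by fast
  then have "oscillation X Y \<Phi> \<delta> \<le> ennreal r"
    unfolding oscillation_def by (intro SUP_least) blast
  also have "\<dots> < \<infinity>" by simp
  finally show "oscillation X Y \<Phi> \<delta> < \<infinity>" .
qed (rule assms(1))

theorem theorem4:
  fixes X :: "'a metric"
  assumes "mspace X \<noteq> {}"
    and "unbounded_geometry X"
  shows "\<exists>S\<subseteq>mspace X. macro_uniformly_equivalent (submetric X S) baire_macro_space"
proof -
  obtain g E where "fan_system X g E"
    using unbounded_geometry_imp_fan_system[OF assms(2)] by blast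
  then interpret fan_system X g E .
  obtain p where p: "p \<in> mspace X"
    using assms(1) by blast
  define S where "S = endpoint p ` baire_carrier"
  define \<Phi> where "\<Phi> = (\<lambda>x. (endpoint p x, x)) ` baire_carrier"
  have S: "S \<subseteq> mspace X" "mspace (submetric X S) = S"
    using p by (auto simp: S_def endpoint_closed)
  have sub: "\<Phi> \<subseteq> mspace (submetric X S) \<times> mspace baire_macro_space"
    unfolding S(2) mspace_baire by (auto simp: S_def \<Phi>_def)
  have "macro_uniform_equivalence (submetric X S) baire_macro_space \<Phi>"
    unfolding macro_uniform_equivalence_def
  proof (intro conjI)
    show "\<Phi>\<inverse> `` mspace baire_macro_space = mspace (submetric X S)"
      and "\<Phi> `` mspace (submetric X S) = mspace baire_macro_space"
      unfolding S(2) mspace_baire by (auto simp: S_def \<Phi>_def)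
    show "macro_uniform (submetric X S) baire_macro_space \<Phi>"
    proof (rule macro_uniformI[OF sub])
      fix \<delta> :: real
      assume "\<delta> \<ge> 0"
      then show "\<exists>r\<ge>0. \<forall>(a, x)\<in>\<Phi>. \<forall>(b, y)\<in>\<Phi>.
          mdist (submetric X S) a b \<le> \<delta> \<longrightarrow> mdist baire_macro_space x y \<le> r"
        by (intro exI[of _ \<delta>])
          (auto simp: \<Phi>_def mdist_baire intro: order_trans[OF endpoint_lower_bound[OF p]])
    qed
    show "macro_uniform baire_macro_space (submetric X S) (\<Phi>\<inverse>)"
    proof (rule macro_uniformI)
      show "\<Phi>\<inverse> \<subseteq> mspace baire_macro_space \<times> mspace (submetric X S)"
        using sub by blast
    next
      fix \<delta> :: real
      assume "\<delta> \<ge> 0"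
      obtain k where k: "\<delta> \<le> real k"
        using real_arch_simple by blast
      have "0 \<le> E k"
        by (rule order_trans[OF nonneg descend_near[OF p]])
      then have "0 \<le> 2 * E k" by simp
      moreover have "mdist X (endpoint p x) (endpoint p y) \<le> 2 * E k"
        if "x \<in> baire_carrier" "y \<in> baire_carrier" "baire_dist x y \<le> \<delta>" for x y
        using endpoint_upper_bound[OF p] that k by fastforce
      ultimately show "\<exists>r\<ge>0. \<forall>(x, a)\<in>\<Phi>\<inverse>. \<forall>(y, b)\<in>\<Phi>\<inverse>.
          mdist baire_macro_space x y \<le> \<delta> \<longrightarrow> mdist (submetric X S) a b \<le> r"
        by (intro exI[of _ "2 * E k"]) (auto simp: \<Phi>_def mdist_baire)
    qed
  qed
  with S(1) show ?thesis
    unfolding macro_uniformly_equivalent_def by blast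
qed

end
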